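(* For every $n\ge 0$, $$R_{n+1}(x,y,z)=L_n(x,y,z)+\sum_{k=1}^{n}\binom{n}{k}A_k(x,y)\,L_{n-k}(x,y,z),$$ where, for $m\ge1$, $$R_m(x,y,z)=\sum_{\sigma\in S_m}x^{\mathrm{jump}(\sigma)}y^{\mathrm{des}(\sigma)}z^{\mathrm{suc}(\sigma)},\qquad L_m(x,y,z)=\sum_{\sigma\in S_m}x^{\mathrm{jump}(\sigma)}y^{\mathrm{des}(\sigma)}z^{\mathrm{lsuc}(\sigma)},$$ $L_0(x,y,z)=1$, and for $k\ge1$ the bivariate Eulerian polynomial is $A_k(x,y)=\sum_{\sigma\in S_k}x^{\mathrm{asc}(\sigma)}y^{\mathrm{des}(\sigma)+1}$.
   Context: $S_m$ is the set of permutations $\sigma=\sigma_1\cdots\sigma_m$ of $[m]$, with $\sigma_0=0$. $\mathrm{asc}(\sigma)$: number of indices $0\le i\le m-1$ with $\sigma_i<\sigma_{i+1}$. $\mathrm{des}(\sigma)$: number of indices $1\le i\le m-1$ with $\sigma_i>\sigma_{i+1}$. $\mathrm{jump}(\sigma)$: number of indices $1\le i\le m$ with $\sigma_i\ge\sigma_{i-1}+2$. $\mathrm{lsuc}(\sigma)$: number of indices $1\le i\le m$ with $\sigma_{i-1}+1=\sigma_i$. $\mathrm{suc}(\sigma)$: number of indices $1\le i\le m-1$ with $\sigma_i+1=\sigma_{i+1}$. (Equivalently, $A_k(x,y)=D^k(x)$ for the derivation $D(x)=D(y)=xy$; e.g. $A_1=xy$, $A_2=xy^2+x^2y$.) *)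

theory Defs
  imports "HOL-Combinatorics.Permutations"
begin

text \<open>
  A permutation \<open>\<sigma>\<^sub>1 \<dots> \<sigma>\<^sub>m\<close> of \<open>{1..m}\<close> is a function \<open>\<sigma>\<close> with
  \<open>\<sigma> permutes {1..m}\<close>. Such a function fixes every point outside \<open>{1..m}\<close>, so the
  convention \<open>\<sigma>\<^sub>0 = 0\<close> holds automatically.
\<close>

definition perms :: "nat \<Rightarrow> (nat \<Rightarrow> nat) set" where
  "perms m = {\<sigma>. \<sigma> permutes {1..m}}"

lemma perms_zero: "\<sigma> \<in> perms m \<Longrightarrow> \<sigma> 0 = 0"
  by (auto simp: perms_def permutes_def)

definition asc :: "nat \<Rightarrow> (nat \<Rightarrow> nat) \<Rightarrow> nat" where
  "asc m \<sigma> = card {i \<in> {0..<m}. \<sigma> i < \<sigma> (i + 1)}"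

definition des :: "nat \<Rightarrow> (nat \<Rightarrow> nat) \<Rightarrow> nat" where
  "des m \<sigma> = card {i \<in> {1..<m}. \<sigma> i > \<sigma> (i + 1)}"

definition jump :: "nat \<Rightarrow> (nat \<Rightarrow> nat) \<Rightarrow> nat" where
  "jump m \<sigma> = card {i \<in> {1..m}. \<sigma> i \<ge> \<sigma> (i - 1) + 2}"

definition lsuc :: "nat \<Rightarrow> (nat \<Rightarrow> nat) \<Rightarrow> nat" where
  "lsuc m \<sigma> = card {i \<in> {1..m}. \<sigma> (i - 1) + 1 = \<sigma> i}"

definition suc :: "nat \<Rightarrow> (nat \<Rightarrow> nat) \<Rightarrow> nat" where
  "suc m \<sigma> = card {i \<in> {1..<m}. \<sigma> i + 1 = \<sigma> (i + 1)}"

text \<open>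
  The polynomials are given by their values at elements of an arbitrary commutative ring.
  An identity between them for all \<open>x\<close>, \<open>y\<close>, \<open>z\<close> in all commutative rings is the same
  as an identity of formal polynomials with integer coefficients: instantiate the ring to
  \<open>int poly poly poly\<close> and \<open>x\<close>, \<open>y\<close>, \<open>z\<close> to the three indeterminates.
\<close>

definition R_poly :: "nat \<Rightarrow> 'a::comm_ring_1 \<Rightarrow> 'a \<Rightarrow> 'a \<Rightarrow> 'a" where
  "R_poly m x y z = (\<Sum>\<sigma>\<in>perms m. x ^ jump m \<sigma> * y ^ des m \<sigma> * z ^ suc m \<sigma>)"

definition L_poly :: "nat \<Rightarrow> 'a::comm_ring_1 \<Rightarrow> 'a \<Rightarrow> 'a \<Rightarrow> 'a" where
  "L_poly m x y z = (\<Sum>\<sigma>\<in>perms m. x ^ jump m \<sigma> * y ^ des m \<sigma> * z ^ lsuc m \<sigma>)"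

text \<open>The separate convention for \<open>L\<^sub>0\<close> is the value of the sum over the empty permutation.\<close>

lemma L_poly_0: "L_poly 0 x y z = 1"
  by (simp add: L_poly_def perms_def jump_def des_def lsuc_def)

definition A_poly :: "nat \<Rightarrow> 'a::comm_ring_1 \<Rightarrow> 'a \<Rightarrow> 'a" where
  "A_poly k x y = (\<Sum>\<sigma>\<in>perms k. x ^ asc k \<sigma> * y ^ (des k \<sigma> + 1))"

end

theory Submission
  imports Defs
begin

text \<open>
  Let \<open>D\<close> be the derivation with \<open>D x = D y = D z = D t = x y\<close>, and weight a permutation by
  \<open>x\<close> to the jumps, \<open>y\<close> to the descents, \<open>z\<close> to the successions and \<open>t\<close> if it starts with 1.
  Inserting a new maximum directly after the old one creates a succession; inserting it into any
  other gap acts on the letter of that gap as \<open>D\<close>. So the weight sum over \<open>S\<^sub>n\<^sub>+\<^sub>1\<close> is \<open>E\<^sup>n t\<close> for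
  \<open>E f = z f + D f\<close>. Setting \<open>t = 1\<close> gives \<open>R\<^sub>n\<^sub>+\<^sub>1\<close>, while \<open>L\<^sub>n = E\<^sup>n 1\<close> and \<open>A\<^sub>k = D\<^sup>k t\<close> for
  \<open>k \<ge> 1\<close>. The identity is the Leibniz rule \<open>E\<^sup>n (f g) = (\<Sum>k. (n choose k) D\<^sup>k f E\<^sup>n\<^sup>-\<^sup>k g)\<close>
  at \<open>f = t\<close>, \<open>g = 1\<close>.
\<close>

section \<open>Transposed operators and the Leibniz rule\<close>

text \<open>
  \<open>D\<close> and \<open>E\<close> are not well defined on polynomial functions over an arbitrary ring. Their transposes
  \<open>der\<close> and \<open>ext_op\<close> act instead on functions \<open>F\<close> of the exponents, \<open>F a b c e\<close> being the value
  at \<open>x\<^sup>a y\<^sup>b z\<^sup>c t\<^sup>e\<close> of a linear functional. The truncation in \<open>c - 1\<close> and \<open>e - 1\<close>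
  is harmless because the coefficient vanishes there.
\<close>

definition der :: "(nat \<Rightarrow> nat \<Rightarrow> nat \<Rightarrow> nat \<Rightarrow> 'a::comm_ring_1) \<Rightarrow> nat \<Rightarrow> nat \<Rightarrow> nat \<Rightarrow> nat \<Rightarrow> 'a" where
  "der F a b c e = of_nat a * F a (Suc b) c e + of_nat b * F (Suc a) b c e
     + of_nat c * F (Suc a) (Suc b) (c - 1) e + of_nat e * F (Suc a) (Suc b) c (e - 1)"

definition ext_op :: "(nat \<Rightarrow> nat \<Rightarrow> nat \<Rightarrow> nat \<Rightarrow> 'a::comm_ring_1) \<Rightarrow> nat \<Rightarrow> nat \<Rightarrow> nat \<Rightarrow> nat \<Rightarrow> 'a" where
  "ext_op F a b c e = F a b (Suc c) e + der F a b c e"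

definition monom4 :: "'a::comm_ring_1 \<Rightarrow> 'a \<Rightarrow> 'a \<Rightarrow> 'a \<Rightarrow> nat \<Rightarrow> nat \<Rightarrow> nat \<Rightarrow> nat \<Rightarrow> 'a" where
  "monom4 x y z t a b c e = x ^ a * y ^ b * z ^ c * t ^ e"

text \<open>This is \<open>D (u v) = D u v + u D v\<close> for two monomials \<open>u\<close> and
  \<open>v\<close>, read through the functional \<open>F\<close>.\<close>

lemma der_add:
  "der F (a + a') (b + b') (c + c') (e + e') =
     der (\<lambda>p q r s. F (p + a') (q + b') (r + c') (s + e')) a b c e +
     der (\<lambda>p q r s. F (a + p) (b + q) (c + r) (e + s)) a' b' c' e'"
proof -
  have 1: "of_nat (c + c') * F (Suc (a + a')) (Suc (b + b')) (c + c' - 1) (e + e') =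
    of_nat c * F (Suc (a + a')) (Suc (b + b')) (c - 1 + c') (e + e') +
    of_nat c' * F (Suc (a + a')) (Suc (b + b')) (c + (c' - 1)) (e + e')"
    by (cases c; cases c') (simp_all add: algebra_simps)
  have 2: "of_nat (e + e') * F (Suc (a + a')) (Suc (b + b')) (c + c') (e + e' - 1) =
    of_nat e * F (Suc (a + a')) (Suc (b + b')) (c + c') (e - 1 + e') +
    of_nat e' * F (Suc (a + a')) (Suc (b + b')) (c + c') (e + (e' - 1))"
    by (cases e; cases e') (simp_all add: algebra_simps)
  show ?thesis
    unfolding der_def 1 2 by (simp add: algebra_simps)
qed

lemma der_sum_left:
  "der (\<lambda>p q r s. \<Sum>k\<in>K. w k * f k p q r s * g k) a b c e = (\<Sum>k\<in>K. w k * der (f k) a b c e * g k)"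
  by (simp add: der_def sum_distrib_left sum_distrib_right sum.distrib algebra_simps)

lemma der_sum_right:
  "der (\<lambda>p q r s. \<Sum>k\<in>K. w k * f k * g k p q r s) a b c e = (\<Sum>k\<in>K. w k * f k * der (g k) a b c e)"
  by (simp add: der_def sum_distrib_left sum_distrib_right sum.distrib algebra_simps)

text \<open>Pascal's rule, after an index shift; it closes the induction in
  \<open>leibniz\<close>.\<close>

lemma binomial_convolution_Suc:
  fixes f g :: "nat \<Rightarrow> 'a::comm_ring_1"
  shows "(\<Sum>k\<le>n. of_nat (n choose k) * f (Suc k) * g (n - k)) +
    (\<Sum>k\<le>n. of_nat (n choose k) * f k * g (Suc (n - k))) =
    (\<Sum>k\<le>Suc n. of_nat (Suc n choose k) * f k * g (Suc n - k))"
proof -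
  have "(\<Sum>k\<le>n. of_nat (n choose k) * f k * g (Suc (n - k))) =
      (\<Sum>k\<le>n. of_nat (n choose k) * f k * g (Suc n - k))"
    by (rule sum.cong) (auto simp: Suc_diff_le)
  also have "\<dots> = (\<Sum>k\<le>Suc n. of_nat (n choose k) * f k * g (Suc n - k))"
    by (simp add: binomial_eq_0)
  also have "\<dots> = f 0 * g (Suc n) + (\<Sum>k\<le>n. of_nat (n choose Suc k) * f (Suc k) * g (n - k))"
    by (subst sum.atMost_Suc_shift) simp
  finally have "(\<Sum>k\<le>n. of_nat (n choose k) * f k * g (Suc (n - k))) = \<dots>" .
  moreover have "(\<Sum>k\<le>Suc n. of_nat (Suc n choose k) * f k * g (Suc n - k)) =
     f 0 * g (Suc n) + (\<Sum>k\<le>n. of_nat (Suc n choose Suc k) * f (Suc k) * g (n - k))"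
    by (subst sum.atMost_Suc_shift) simp
  ultimately show ?thesis
    by (simp add: sum.distrib algebra_simps)
qed

lemma leibniz:
  fixes M :: "nat \<Rightarrow> nat \<Rightarrow> nat \<Rightarrow> nat \<Rightarrow> 'a::comm_ring_1"
  assumes M: "\<And>a b c e a' b' c' e'. M (a + a') (b + b') (c + c') (e + e') = M a b c e * M a' b' c' e'"
  shows "(ext_op ^^ n) M (a + a') (b + b') (c + c') (e + e') =
    (\<Sum>k\<le>n. of_nat (n choose k) * (der ^^ k) M a b c e * (ext_op ^^ (n - k)) M a' b' c' e')"
proof (induction n arbitrary: a b c e a' b' c' e')
  case 0
  then show ?case by (simp add: M)
next
  case (Suc n)
  let ?E = "(ext_op ^^ n) M"
  have ext_Suc: "(ext_op ^^ Suc k) M p q r s =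
      (ext_op ^^ k) M p q (Suc r) s + der ((ext_op ^^ k) M) p q r s" for k p q r s
    by (simp add: ext_op_def)
  have der_Suc: "(der ^^ Suc k) M = der ((der ^^ k) M)" for k
    by simp
  \<comment> \<open>The factor \<open>z\<close> in \<open>E\<close> is charged to the second
    monomial alone: \<open>E (f g) = D f g + f E g\<close>.\<close>
  have shift: "?E (a + a') (b + b') (Suc (c + c')) (e + e') =
     (\<Sum>k\<le>n. of_nat (n choose k) * (der ^^ k) M a b c e * (ext_op ^^ (n - k)) M a' b' (Suc c') e')"
    using Suc.IH[of a a' b b' c "Suc c'" e e'] by simp
  have der: "der ?E (a + a') (b + b') (c + c') (e + e') =
     (\<Sum>k\<le>n. of_nat (n choose k) * der ((der ^^ k) M) a b c e * (ext_op ^^ (n - k)) M a' b' c' e') +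
     (\<Sum>k\<le>n. of_nat (n choose k) * (der ^^ k) M a b c e * der ((ext_op ^^ (n - k)) M) a' b' c' e')"
    unfolding der_add Suc.IH by (simp only: der_sum_left der_sum_right)
  have "(ext_op ^^ Suc n) M (a + a') (b + b') (c + c') (e + e') =
     (\<Sum>k\<le>n. of_nat (n choose k) * (der ^^ Suc k) M a b c e * (ext_op ^^ (n - k)) M a' b' c' e') +
     (\<Sum>k\<le>n. of_nat (n choose k) * (der ^^ k) M a b c e * (ext_op ^^ Suc (n - k)) M a' b' c' e')"
    unfolding ext_Suc der_Suc shift der by (simp only: distrib_left sum.distrib ac_simps)
  then show ?case
    by (simp only: binomial_convolution_Suc[where f = "\<lambda>k. (der ^^ k) M a b c e" and g = "\<lambda>k. (ext_op ^^ k) M a' b' c' e'"])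
qed

section \<open>Insertion of a new maximum\<close>

definition ins :: "nat \<Rightarrow> nat \<Rightarrow> (nat \<Rightarrow> nat) \<Rightarrow> nat \<Rightarrow> nat" where
  "ins m j \<sigma> i = (if i \<le> j then \<sigma> i else if i = Suc j then Suc m
     else if i \<le> Suc m then \<sigma> (i - 1) else i)"

lemma perms_le:
  assumes "\<sigma> \<in> perms m" "i \<le> m" shows "\<sigma> i \<le> m"
proof (cases "i = 0")
  case True
  with perms_zero[OF assms(1)] show ?thesis by simp
next
  case False
  with assms have "i \<in> {1..m}" by simp
  with assms(1) have "\<sigma> i \<in> {1..m}"
    unfolding perms_def mem_Collect_eq by (simp only: permutes_in_image)
  then show ?thesis by simp
qed

lemma perms_inj: "\<sigma> \<in> perms m \<Longrightarrow> \<sigma> i = \<sigma> j \<longleftrightarrow> i = j"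
  unfolding perms_def mem_Collect_eq by (metis permutes_inj inj_eq)

lemma perms_gt: "\<sigma> \<in> perms m \<Longrightarrow> m < i \<Longrightarrow> \<sigma> i = i"
  by (auto simp: perms_def permutes_def)

lemma ins_perms:
  assumes \<sigma>: "\<sigma> \<in> perms m" and j: "j \<le> m"
  shows "ins m j \<sigma> \<in> perms (Suc m)"
proof -
  \<comment> \<open>The inserted word is \<sigma> after a permutation \<open>c\<close> of the
    positions, which sends \<open>Suc j\<close> to the point \<open>Suc m\<close> fixed by
    \<sigma>.\<close>
  define c where "c i = (if i \<le> j then i else if i = Suc j then Suc m
     else if i \<le> Suc m then i - 1 else i)" for i
  have "inj_on c {1..Suc m}" "c ` {1..Suc m} \<subseteq> {1..Suc m}"
    using j by (auto simp: inj_on_def c_def split: if_splits)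
  then have "bij_betw c {1..Suc m} {1..Suc m}"
    by (simp add: bij_betw_def endo_inj_surj)
  then have "c permutes {1..Suc m}"
    by (rule bij_imp_permutes) (use j in \<open>auto simp: c_def\<close>)
  moreover have "\<sigma> permutes {1..Suc m}"
    using \<sigma> unfolding perms_def mem_Collect_eq by (rule permutes_subset) auto
  ultimately have "\<sigma> \<circ> c permutes {1..Suc m}"
    by (rule permutes_compose)
  moreover have "\<sigma> \<circ> c = ins m j \<sigma>"
    using perms_gt[OF \<sigma>] by (auto simp: fun_eq_iff c_def ins_def)
  ultimately show ?thesis by (simp add: perms_def)
qed

lemma ins_eq_max_iff:
  assumes "\<sigma> \<in> perms m" "j \<le> m"
  shows "ins m j \<sigma> i = Suc m \<longleftrightarrow> i = Suc j"
  using perms_inj[OF ins_perms[OF assms], of i "Suc j"] by (simp add: ins_def)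

text \<open>The place of the maximum recovers \<open>j\<close>; the other entries recover the
  word.\<close>

lemma ins_inj:
  "inj_on (\<lambda>(\<sigma>, j). ins m j \<sigma>) (perms m \<times> {..m})"
proof (rule inj_onI, clarify)
  fix \<sigma> j \<tau> k
  assume *: "\<sigma> \<in> perms m" "j \<le> m" "\<tau> \<in> perms m" "k \<le> m" and eq: "ins m j \<sigma> = ins m k \<tau>"
  have "j = k"
    using ins_eq_max_iff[OF *(1,2), of "Suc j"] ins_eq_max_iff[OF *(3,4), of "Suc j"] eq by simp
  moreover have "\<sigma> i = \<tau> i" for i
  proof -
    consider "i \<le> j" | "j < i" "i \<le> m" | "m < i" by linarith
    then show ?thesis
    proof cases
      case 1
      then show ?thesis using fun_cong[OF eq, of i] \<open>j = k\<close> by (simp add: ins_def)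
    next
      case 2
      then show ?thesis using fun_cong[OF eq, of "Suc i"] \<open>j = k\<close> by (simp add: ins_def)
    next
      case 3
      then show ?thesis using * by (simp add: perms_gt)
    qed
  qed
  ultimately show "\<sigma> = \<tau> \<and> j = k" by auto
qed

lemma finite_perms: "finite (perms m)"
  by (simp add: perms_def finite_permutations)

lemma card_perms: "card (perms m) = fact m"
  unfolding perms_def by (rule card_permutations) auto

text \<open>Surjectivity follows by counting, from
  \<open>Suc m * fact m = fact (Suc m)\<close>.\<close>

lemma ins_bij:
  "bij_betw (\<lambda>(\<sigma>, j). ins m j \<sigma>) (perms m \<times> {..m}) (perms (Suc m))"
proof -
  have "(\<lambda>(\<sigma>, j). ins m j \<sigma>) ` (perms m \<times> {..m}) = perms (Suc m)"
  proof (rule card_subset_eq[OF finite_perms])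
    show "(\<lambda>(\<sigma>, j). ins m j \<sigma>) ` (perms m \<times> {..m}) \<subseteq> perms (Suc m)"
      using ins_perms by auto
    show "card ((\<lambda>(\<sigma>, j). ins m j \<sigma>) ` (perms m \<times> {..m})) = card (perms (Suc m))"
      by (simp add: card_image[OF ins_inj] card_cartesian_product card_perms)
  qed
  then show ?thesis using ins_inj by (simp add: bij_betw_def)
qed

lemma sum_perms_Suc:
  "(\<Sum>\<sigma>\<in>perms (Suc m). f \<sigma>) = (\<Sum>\<sigma>\<in>perms m. \<Sum>j\<le>m. f (ins m j \<sigma>))"
  by (simp add: sum.reindex_bij_betw[OF ins_bij, symmetric] sum.cartesian_product case_prod_unfold)

section \<open>Statistics as sums over adjacent pairs\<close>

definition gap_sum :: "(nat \<Rightarrow> nat \<Rightarrow> nat) \<Rightarrow> nat \<Rightarrow> (nat \<Rightarrow> nat) \<Rightarrow> nat" where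
  "gap_sum f m \<sigma> = (\<Sum>i<m. f (\<sigma> i) (\<sigma> (Suc i)))"

text \<open>Insertion replaces the pair at gap \<open>j\<close> by two pairs around the new maximum;
  at \<open>j = m\<close> one pair is gained and none lost. The lost term stands on the left to
  avoid truncated subtraction.\<close>

lemma gap_sum_ins:
  assumes j: "j \<le> m"
  shows "gap_sum f (Suc m) (ins m j \<sigma>) + (if j < m then f (\<sigma> j) (\<sigma> (Suc j)) else 0) =
    gap_sum f m \<sigma> + f (\<sigma> j) (Suc m) + (if j < m then f (Suc m) (\<sigma> (Suc j)) else 0)"
proof (cases "j = m")
  case True
  then show ?thesis by (simp add: gap_sum_def ins_def)
next
  case False
  with j obtain d where m: "m = Suc (j + d)"
    by (metis less_imp_Suc_add le_neq_implies_less)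
  have split: "(\<Sum>i<Suc (j + k). h i) = (\<Sum>i<j. h i) + h j + (\<Sum>i<k. h (Suc (j + i)))"
    for h :: "nat \<Rightarrow> nat" and k
    by (induction k) auto
  have index: "Suc (Suc (j + d)) = Suc (j + Suc d)"
    by simp
  have "gap_sum f (Suc m) (ins m j \<sigma>) =
      (\<Sum>i<j. f (ins m j \<sigma> i) (ins m j \<sigma> (Suc i))) + f (ins m j \<sigma> j) (ins m j \<sigma> (Suc j)) +
      (f (ins m j \<sigma> (Suc j)) (ins m j \<sigma> (Suc (Suc j))) +
      (\<Sum>i<d. f (ins m j \<sigma> (Suc (Suc (j + i)))) (ins m j \<sigma> (Suc (Suc (Suc (j + i)))))))"
    unfolding gap_sum_def m index split by (simp add: sum.lessThan_Suc_shift[of _ d] del: sum.lessThan_Suc)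
  also have "\<dots> = (\<Sum>i<j. f (\<sigma> i) (\<sigma> (Suc i))) + f (\<sigma> j) (Suc m) +
     (f (Suc m) (\<sigma> (Suc j)) + (\<Sum>i<d. f (\<sigma> (Suc (j + i))) (\<sigma> (Suc (Suc (j + i))))))"
    by (simp add: ins_def m)
  finally have "gap_sum f (Suc m) (ins m j \<sigma>) = \<dots>" .
  moreover have "gap_sum f m \<sigma> = (\<Sum>i<j. f (\<sigma> i) (\<sigma> (Suc i))) + f (\<sigma> j) (\<sigma> (Suc j)) +
     (\<Sum>i<d. f (\<sigma> (Suc (j + i))) (\<sigma> (Suc (Suc (j + i)))))"
    unfolding gap_sum_def m by (rule split)
  ultimately show ?thesis using m by simp
qed

text \<open>The exponent of \<open>t\<close>: for a permutation with \<open>m > 0\<close> it is 1 if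
  the word starts with 1, and 0 otherwise.\<close>

definition first :: "nat \<Rightarrow> (nat \<Rightarrow> nat) \<Rightarrow> nat" where
  "first m \<sigma> = gap_sum (\<lambda>a b. of_bool (a = 0 \<and> b = 1)) m \<sigma>"

lemma card_Suc_shift: "card {i \<in> {1..m}. P i} = card {i. i < m \<and> P (Suc i)}"
proof -
  have "{i \<in> {1..m}. P i} = Suc ` {i. i < m \<and> P (Suc i)}"
    by (auto simp: image_iff) (metis Suc_le_eq Suc_pred)
  then show ?thesis by (simp add: card_image)
qed

lemma gap_sum_of_bool:
  "gap_sum (\<lambda>a b. of_bool (P a b)) m \<sigma> = card {i. i < m \<and> P (\<sigma> i) (\<sigma> (Suc i))}"
  by (simp add: gap_sum_def Int_def lessThan_def)

lemma jump_eq: "jump m \<sigma> = gap_sum (\<lambda>a b. of_bool (a + 2 \<le> b)) m \<sigma>"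
  unfolding jump_def gap_sum_of_bool card_Suc_shift by simp

lemma lsuc_eq: "lsuc m \<sigma> = gap_sum (\<lambda>a b. of_bool (Suc a = b)) m \<sigma>"
  unfolding lsuc_def gap_sum_of_bool card_Suc_shift by simp

lemma asc_eq: "asc m \<sigma> = gap_sum (\<lambda>a b. of_bool (a < b)) m \<sigma>"
  unfolding asc_def gap_sum_of_bool by simp

text \<open>The gap sum also covers index 0, which is no descent because
  \<open>\<sigma> 0 = 0\<close>.\<close>

lemma des_eq:
  assumes "\<sigma> \<in> perms m"
  shows "des m \<sigma> = gap_sum (\<lambda>a b. of_bool (b < a)) m \<sigma>"
proof -
  have "0 < i" if "\<sigma> (Suc i) < \<sigma> i" for i
    using that perms_zero[OF assms] by (cases i) auto
  then have "{i \<in> {1..<m}. \<sigma> i > \<sigma> (i + 1)} = {i. i < m \<and> \<sigma> (Suc i) < \<sigma> i}"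
    by (auto simp: Suc_le_eq)
  then show ?thesis unfolding des_def gap_sum_of_bool by simp
qed

text \<open>The value 0 occurs only at index 0, so \<open>0 < a\<close> drops exactly that
  pair.\<close>

lemma suc_eq:
  assumes "\<sigma> \<in> perms m"
  shows "suc m \<sigma> = gap_sum (\<lambda>a b. of_bool (0 < a \<and> Suc a = b)) m \<sigma>"
proof -
  have "0 < \<sigma> i \<longleftrightarrow> 0 < i" for i
    using perms_inj[OF assms, of i 0] perms_zero[OF assms] by (simp add: neq0_conv[symmetric] del: neq0_conv)
  then have "{i \<in> {1..<m}. \<sigma> i + 1 = \<sigma> (i + 1)} = {i. i < m \<and> 0 < \<sigma> i \<and> Suc (\<sigma> i) = \<sigma> (Suc i)}"
    by (auto simp: Suc_le_eq)
  then show ?thesis unfolding suc_def gap_sum_of_bool by simp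
qed

lemma lsuc_split:
  assumes "\<sigma> \<in> perms m"
  shows "lsuc m \<sigma> = suc m \<sigma> + first m \<sigma>"
  unfolding lsuc_eq suc_eq[OF assms] first_def gap_sum_def sum.distrib[symmetric]
  by (rule sum.cong) auto

lemma asc_split:
  assumes "\<sigma> \<in> perms m"
  shows "asc m \<sigma> = jump m \<sigma> + suc m \<sigma> + first m \<sigma>"
  unfolding asc_eq jump_eq suc_eq[OF assms] first_def gap_sum_def sum.distrib[symmetric]
  by (rule sum.cong) auto

section \<open>Insertion as one application of \<open>E\<close>\<close>

text \<open>The gap after the old maximum yields \<open>z\<close>. Any other inner gap has its
  letter replaced by \<open>x y\<close>, as the new maximum is entered by a jump and left by a
  descent. \<open>m > 0\<close> keeps the old maximum apart from
  \<open>\<sigma> 0 = 0\<close>.\<close>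

lemma sum_ins:
  fixes F :: "nat \<Rightarrow> nat \<Rightarrow> nat \<Rightarrow> nat \<Rightarrow> 'a::comm_ring_1"
  assumes \<sigma>: "\<sigma> \<in> perms m" and m: "m > 0"
  shows "(\<Sum>j\<le>m. F (jump (Suc m) (ins m j \<sigma>)) (des (Suc m) (ins m j \<sigma>))
      (suc (Suc m) (ins m j \<sigma>)) (first (Suc m) (ins m j \<sigma>))) =
    ext_op F (jump m \<sigma>) (des m \<sigma>) (suc m \<sigma>) (first m \<sigma>)"
proof -
  let ?J = "jump m \<sigma>" and ?D = "des m \<sigma>" and ?S = "suc m \<sigma>" and ?T = "first m \<sigma>"
  let ?b = "\<lambda>j P. of_bool (j < m \<and> P (\<sigma> j) (\<sigma> (Suc j))) :: 'a"
  have J: "jump (Suc m) (ins m j \<sigma>) + of_bool (j < m \<and> \<sigma> j + 2 \<le> \<sigma> (Suc j)) =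
      ?J + of_bool (\<sigma> j \<noteq> m)" if "j \<le> m" for j
    using gap_sum_ins[OF that, of "\<lambda>a b. of_bool (a + 2 \<le> b)" \<sigma>] perms_le[OF \<sigma> that]
      perms_le[OF \<sigma>, of "Suc j"]
    by (auto simp: jump_eq split: if_splits)
  have D: "des (Suc m) (ins m j \<sigma>) + of_bool (j < m \<and> \<sigma> (Suc j) < \<sigma> j) =
      ?D + of_bool (j < m)" if "j \<le> m" for j
    using gap_sum_ins[OF that, of "\<lambda>a b. of_bool (b < a)" \<sigma>] perms_le[OF \<sigma> that]
      perms_le[OF \<sigma>, of "Suc j"]
    by (auto simp: des_eq[OF \<sigma>] des_eq[OF ins_perms[OF \<sigma> that]] split: if_splits)
  have S: "suc (Suc m) (ins m j \<sigma>) + of_bool (j < m \<and> 0 < \<sigma> j \<and> Suc (\<sigma> j) = \<sigma> (Suc j)) =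
      ?S + of_bool (\<sigma> j = m)" if "j \<le> m" for j
    using gap_sum_ins[OF that, of "\<lambda>a b. of_bool (0 < a \<and> Suc a = b)" \<sigma>] perms_le[OF \<sigma> that]
      perms_le[OF \<sigma>, of "Suc j"] m
    by (auto simp: suc_eq[OF \<sigma>] suc_eq[OF ins_perms[OF \<sigma> that]] split: if_splits)
  have T: "first (Suc m) (ins m j \<sigma>) + of_bool (j < m \<and> \<sigma> j = 0 \<and> \<sigma> (Suc j) = 1) = ?T"
    if "j \<le> m" for j
    using gap_sum_ins[OF that, of "\<lambda>a b. of_bool (a = 0 \<and> b = 1)" \<sigma>] perms_le[OF \<sigma> that] m
    by (auto simp: first_def split: if_splits)
  \<comment> \<open>The last coefficient counts the gap after position \<open>m\<close> as a descent, but leaves out the one after the maximum.\<close>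
  let ?G = "\<lambda>j. of_bool (\<sigma> j = m) * F ?J ?D (Suc ?S) ?T + ?b j (\<lambda>a b. a + 2 \<le> b) * F ?J (Suc ?D) ?S ?T +
    ?b j (\<lambda>a b. 0 < a \<and> Suc a = b) * F (Suc ?J) (Suc ?D) (?S - 1) ?T +
    ?b j (\<lambda>a b. a = 0 \<and> b = 1) * F (Suc ?J) (Suc ?D) ?S (?T - 1) +
    (?b j (\<lambda>a b. b < a) + of_bool (j = m) - of_bool (\<sigma> j = m)) * F (Suc ?J) ?D ?S ?T"
  have summand: "F (jump (Suc m) (ins m j \<sigma>)) (des (Suc m) (ins m j \<sigma>))
      (suc (Suc m) (ins m j \<sigma>)) (first (Suc m) (ins m j \<sigma>)) =
    ?G j"
    if j: "j \<in> {..m}" for j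
  proof -
    have j': "j \<le> m" using j by simp
    note eqs = J[OF j'] D[OF j'] S[OF j'] T[OF j']
    have lt: "\<sigma> (Suc j) \<le> m" if "j < m" using perms_le[OF \<sigma>, of "Suc j"] that by simp
    have ne: "\<sigma> (Suc j) \<noteq> \<sigma> j" using perms_inj[OF \<sigma>] by simp
    consider (max) "\<sigma> j = m" | (last) "\<sigma> j \<noteq> m" "j = m"
      | (jump) "\<sigma> j \<noteq> m" "j < m" "\<sigma> j + 2 \<le> \<sigma> (Suc j)"
      | (suc) "\<sigma> j \<noteq> m" "j < m" "0 < \<sigma> j" "Suc (\<sigma> j) = \<sigma> (Suc j)"
      | (first) "\<sigma> j \<noteq> m" "j < m" "\<sigma> j = 0" "\<sigma> (Suc j) = 1"
      | (des) "\<sigma> j \<noteq> m" "j < m" "\<sigma> (Suc j) < \<sigma> j"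
      using j' ne by linarith
    then show ?thesis
    proof cases
      case max
      show ?thesis
      proof (cases "j < m")
        case True
        then have "\<sigma> (Suc j) < \<sigma> j" using lt ne max by linarith
        then show ?thesis using eqs max True m by simp
      next
        case False
        then show ?thesis using eqs max j' by simp
      qed
    next
      case last
      then show ?thesis using eqs by simp
    next
      case jump
      then show ?thesis using eqs by simp
    next
      case suc
      then have "suc (Suc m) (ins m j \<sigma>) = ?S - 1" using eqs by simp
      then show ?thesis using eqs suc by simp
    next
      case first
      then have "first (Suc m) (ins m j \<sigma>) = ?T - 1" using eqs by simp
      then show ?thesis using eqs first by simp
    next
      case des
      then show ?thesis using eqs by simp
    qed
  qed
  have count: "(\<Sum>j\<le>m. ?b j P) = of_nat (gap_sum (\<lambda>a b. of_bool (P a b)) m \<sigma>)" for P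
  proof -
    have "(\<Sum>j\<le>m. ?b j P) = (\<Sum>j<m. ?b j P)"
      by (simp add: lessThan_Suc_atMost[symmetric])
    also have "\<dots> = of_nat (gap_sum (\<lambda>a b. of_bool (P a b)) m \<sigma>)"
      unfolding gap_sum_def of_nat_sum by (rule sum.cong) auto
    finally show ?thesis .
  qed
  have "\<exists>i\<in>{1..m}. \<sigma> i = m"
  proof -
    have "\<sigma> ` {1..m} = {1..m}"
      using \<sigma> unfolding perms_def mem_Collect_eq by (rule permutes_image)
    moreover have "m \<in> {1..m}" using m by simp
    ultimately show ?thesis by (metis imageE)
  qed
  then obtain i where i: "i \<le> m" "\<sigma> i = m" by auto
  then have "\<sigma> j = m \<longleftrightarrow> j = i" for j
    using perms_inj[OF \<sigma>, of j i] by simp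
  then have one: "(\<Sum>j\<le>m. of_bool (\<sigma> j = m)) = (1 :: 'a)"
    using i by (simp add: of_bool_def sum.delta)
  \<comment> \<open>Together with \<open>one\<close> this cancels the correction in the last
    coefficient of \<open>?G\<close>, leaving the number of descents.\<close>
  have last: "(\<Sum>j\<le>m. of_bool (j = m)) = (1 :: 'a)"
    by (simp add: of_bool_def sum.delta)
  have "(\<Sum>j\<le>m. F (jump (Suc m) (ins m j \<sigma>)) (des (Suc m) (ins m j \<sigma>))
      (suc (Suc m) (ins m j \<sigma>)) (first (Suc m) (ins m j \<sigma>))) = (\<Sum>j\<le>m. ?G j)"
    by (rule sum.cong[OF refl summand])
  also have "\<dots> = ext_op F ?J ?D ?S ?T"
    by (simp only: sum.distrib sum_subtractf sum_distrib_right[symmetric] one last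
        count[of "\<lambda>a b. a + 2 \<le> b", folded jump_eq]
        count[of "\<lambda>a b. b < a", folded des_eq[OF \<sigma>]]
        count[of "\<lambda>a b. 0 < a \<and> Suc a = b", folded suc_eq[OF \<sigma>]]
        count[of "\<lambda>a b. a = 0 \<and> b = 1", folded first_def]
        ext_op_def der_def add_diff_cancel_left' mult_1_left add_ac)
  finally show ?thesis .
qed

definition stat_sum :: "nat \<Rightarrow> (nat \<Rightarrow> nat \<Rightarrow> nat \<Rightarrow> nat \<Rightarrow> 'a::comm_ring_1) \<Rightarrow> 'a" where
  "stat_sum m F = (\<Sum>\<sigma>\<in>perms m. F (jump m \<sigma>) (des m \<sigma>) (suc m \<sigma>) (first m \<sigma>))"

lemma stat_sum_1: "stat_sum (Suc 0) F = F 0 0 0 1"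
proof -
  have "perms (Suc 0) = {id}" by (simp add: perms_def)
  moreover have "jump (Suc 0) id = 0" "first (Suc 0) id = 1"
    by (simp_all add: jump_eq first_def gap_sum_def)
  moreover have "des (Suc 0) id = 0" "suc (Suc 0) id = 0"
    by (simp_all add: des_def suc_def)
  ultimately show ?thesis by (simp add: stat_sum_def)
qed

lemma stat_sum_Suc: "m > 0 \<Longrightarrow> stat_sum (Suc m) F = stat_sum m (ext_op F)"
  unfolding stat_sum_def sum_perms_Suc by (rule sum.cong[OF refl]) (rule sum_ins)

text \<open>The only word of length 1 has weight \<open>t\<close>, hence the exponents
  \<open>0 0 0 1\<close>; each further letter contributes one \<open>ext_op\<close>.\<close>

lemma stat_sum_eq: "stat_sum (Suc n) F = (ext_op ^^ n) F 0 0 0 1"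
proof (induction n arbitrary: F)
  case 0
  show ?case by (simp only: stat_sum_1 funpow_0)
next
  case (Suc n)
  then show ?case by (simp only: stat_sum_Suc[of "Suc n"] zero_less_Suc funpow_Suc_right comp_apply)
qed

section \<open>Specializations to the three polynomials\<close>

lemma R_poly_eq: "R_poly (Suc n) x y z = (ext_op ^^ n) (monom4 x y z 1) 0 0 0 1"
  unfolding stat_sum_eq[symmetric] by (simp add: R_poly_def stat_sum_def monom4_def)

text \<open>
  \<open>merge_z\<close> is the transpose of the substitution \<open>t = z\<close>, which commutes with \<open>D\<close>; \<open>merge_x\<close> is the
  transpose of \<open>f \<mapsto> y f\<close> after \<open>z = t = x\<close>, where \<open>y\<close> stands for the descent at the end of the word.
\<close>

definition merge_z :: "(nat \<Rightarrow> nat \<Rightarrow> nat \<Rightarrow> nat \<Rightarrow> 'a) \<Rightarrow> nat \<Rightarrow> nat \<Rightarrow> nat \<Rightarrow> nat \<Rightarrow> 'a" where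
  "merge_z F a b c e = F a b (c + e) 0"

lemma ext_merge_z: "ext_op (merge_z F) = merge_z (ext_op F)"
proof (intro HOL.ext)
  fix a b c e
  show "ext_op (merge_z F) a b c e = merge_z (ext_op F) a b c e"
    by (cases c; cases e) (simp_all add: ext_op_def der_def merge_z_def algebra_simps)
qed

lemma L_poly_eq: "L_poly n x y z = (ext_op ^^ n) (monom4 x y z t) 0 0 0 0"
proof (cases n)
  case 0
  then show ?thesis by (simp add: L_poly_0 monom4_def)
next
  case (Suc k)
  have "L_poly n x y z = stat_sum (Suc k) (merge_z (monom4 x y z t))"
    unfolding L_poly_def stat_sum_def Suc
    by (rule sum.cong) (auto simp: merge_z_def monom4_def lsuc_split)
  also have "\<dots> = (ext_op ^^ k) (merge_z (monom4 x y z t)) 0 0 0 1"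
    by (rule stat_sum_eq)
  also have "(ext_op ^^ k) (merge_z (monom4 x y z t)) = merge_z ((ext_op ^^ k) (monom4 x y z t))"
    by (induction k) (simp_all add: ext_merge_z)
  \<comment> \<open>The starting weight \<open>t\<close> has become \<open>z = E 1\<close>, which
    supplies the missing application of \<open>E\<close>.\<close>
  finally show ?thesis by (simp add: Suc merge_z_def ext_op_def der_def)
qed

definition merge_x :: "(nat \<Rightarrow> nat \<Rightarrow> nat \<Rightarrow> nat \<Rightarrow> 'a) \<Rightarrow> nat \<Rightarrow> nat \<Rightarrow> nat \<Rightarrow> nat \<Rightarrow> 'a" where
  "merge_x F a b c e = F (a + c + e) (Suc b) 0 0"

text \<open>At \<open>z = t = x\<close> one has \<open>D (y f) = y (x f + D f)\<close>: the term
  \<open>z f\<close> of \<open>E\<close> is what \<open>D\<close> produces from the extra letter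
  \<open>y\<close>.\<close>

lemma ext_merge_x: "ext_op (merge_x F) = merge_x (der F)"
proof (intro HOL.ext)
  fix a b c e
  show "ext_op (merge_x F) a b c e = merge_x (der F) a b c e"
    by (cases c; cases e) (simp_all add: ext_op_def der_def merge_x_def algebra_simps)
qed

lemma A_poly_eq: "A_poly (Suc k) x y = (der ^^ Suc k) (monom4 x y z t) 0 0 0 1"
proof -
  have "A_poly (Suc k) x y = stat_sum (Suc k) (merge_x (monom4 x y z t))"
    unfolding A_poly_def stat_sum_def
    by (rule sum.cong) (auto simp: merge_x_def monom4_def asc_split)
  also have "\<dots> = (ext_op ^^ k) (merge_x (monom4 x y z t)) 0 0 0 1"
    by (rule stat_sum_eq)
  also have "(ext_op ^^ k) (merge_x (monom4 x y z t)) = merge_x ((der ^^ k) (monom4 x y z t))"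
    by (induction k) (simp_all add: ext_merge_x)
  \<comment> \<open>The starting weight \<open>t\<close> has become \<open>x y = D t\<close>, hence
    one more \<open>der\<close>.\<close>
  finally show ?thesis by (simp add: merge_x_def der_def)
qed

theorem theorem3p9:
  fixes n :: nat and x y z :: "'a::comm_ring_1"
  shows "R_poly (n + 1) x y z =
    L_poly n x y z + (\<Sum>k=1..n. of_nat (n choose k) * A_poly k x y * L_poly (n - k) x y z)"
proof -
  let ?M = "monom4 x y z 1"
  have "R_poly (n + 1) x y z =
      (\<Sum>k\<le>n. of_nat (n choose k) * (der ^^ k) ?M 0 0 0 1 * (ext_op ^^ (n - k)) ?M 0 0 0 0)"
    \<comment> \<open>The monomial \<open>t\<close> is split as \<open>t\<close> times 1.\<close>
    using leibniz[of ?M n 0 0 0 0 0 0 1 0]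
    by (simp add: R_poly_eq monom4_def power_add algebra_simps)
  also have "\<dots> = (ext_op ^^ n) ?M 0 0 0 0 +
      (\<Sum>k=1..n. of_nat (n choose k) * (der ^^ k) ?M 0 0 0 1 * (ext_op ^^ (n - k)) ?M 0 0 0 0)"
    \<comment> \<open>The term \<open>k = 0\<close> is split off because \<open>A_poly_eq\<close>
      needs \<open>k \<ge> 1\<close>; its first factor is \<open>t = 1\<close>.\<close>
    by (simp add: atMost_atLeast0 sum.atLeast_Suc_atMost monom4_def)
  also have "(\<Sum>k=1..n. of_nat (n choose k) * (der ^^ k) ?M 0 0 0 1 * (ext_op ^^ (n - k)) ?M 0 0 0 0) =
      (\<Sum>k=1..n. of_nat (n choose k) * A_poly k x y * L_poly (n - k) x y z)"
  proof (rule sum.cong[OF refl])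
    fix k assume "k \<in> {1..n}"
    then obtain l where k: "k = Suc l" by (cases k) auto
    show "of_nat (n choose k) * (der ^^ k) ?M 0 0 0 1 * (ext_op ^^ (n - k)) ?M 0 0 0 0 =
        of_nat (n choose k) * A_poly k x y * L_poly (n - k) x y z"
      by (simp only: k A_poly_eq[of l x y z 1] L_poly_eq[of "n - Suc l" x y z 1])
  qed
  finally show ?thesis by (simp only: L_poly_eq[of n x y z 1])
qed

end
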